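(* Let $\Gamma\subset\mathrm{PSL}_2(\mathbb{R})$ be a discrete cofinite subgroup with precisely one cusp, at $i\infty$, of genus $g=1$, and with $T\Gamma T=\Gamma$ where $T(z)=-\overline z$. Let $f\in S_2(\Gamma)$ be the unique cusp form with real Fourier coefficients and first nonzero Fourier coefficient equal to $1$, and put $\alpha_1=\Re(f(z)dz)$, $\alpha_2=\Im(f(z)dz)$. Let $s_j=1/2+ir_j$, $r_j\in\mathbb{R}\setminus\{0\}$, be a simple embedded eigenvalue with even eigenfunction, and let $s_j(\epsilon_1,\epsilon_2)$ be the corresponding singular point for the two-parameter character perturbation induced by $(\alpha_1,\alpha_2)$. Assume that $$\frac{\partial^2}{\partial\epsilon_2^2}\Re(s_j(\epsilon_1,\epsilon_2))\Big|_{(\epsilon_1,\epsilon_2)=(0,0)}\neq0$$ and that for some $l\ge1$ $$\frac{\partial^l}{\partial\epsilon_1^l}\Re(s_j(\epsilon_1,\epsilon_2))\Big|_{(\epsilon_1,\epsilon_2)=(0,0)}\neq0.$$ Then $\Re(s_j(\epsilon_1,\epsilon_2))<1/2$ in a punctured neighborhood of $(0,0)$, i.e. the cuspidal eigenvalue becomes a resonance in this punctured neighborhood.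
   Context: $\mathbb{H}$ is the upper half-plane, $\Delta=y^2(\partial_x^2+\partial_y^2)$, the stabilizer $\Gamma_\infty$ of the cusp is generated by $z\mapsto z+1$, and $S_2(\Gamma)$ is the space of weight $2$ holomorphic cusp forms, of complex dimension equal to the genus. A function $h$ is even if $h(Tz)=h(z)$. $s_j$ is a simple embedded eigenvalue if $s_j(1-s_j)$ is an eigenvalue of $-\Delta$ on $L^2(\Gamma\backslash\mathbb{H})$ with one-dimensional eigenspace. Two-parameter character perturbation: for $\underline\epsilon=(\epsilon_1,\epsilon_2)\in\mathbb{R}^2$ and fixed $z_0\in\mathbb{H}$, $\chi(\gamma,\underline\epsilon)=\exp\big(-2\pi i\sum_{l=1}^2\epsilon_l\int_{z_0}^{\gamma z_0}\alpha_l\big)$, with the Laplacian $\tilde L(\underline\epsilon)$ acting on $L^2(\Gamma\backslash\mathbb{H},\overline\chi(\cdot,\underline\epsilon))$ (functions with $h(\gamma z)=\overline\chi(\gamma,\underline\epsilon)h(z)$), and Eisenstein series continuing $E(z,s,\underline\epsilon)=\sum_{\gamma\in\Gamma_\infty\backslash\Gamma}\chi(\gamma,\underline\epsilon)\Im(\gamma z)^s$, with $E(z,s,\underline\epsilon)=\phi(s,\underline\epsilon)E(z,1-s,\underline\epsilon)$. Off the real axis, singular points at $\underline\epsilon$ are the $s$ on $\Re s=1/2$ with $s(1-s)$ an eigenvalue of $-\tilde L(\underline\epsilon)$ (with multiplicity), and the resonances, i.e. poles of $\phi(s,\underline\epsilon)$ in $\Re s<1/2$ (with pole order). For small $\underline\epsilon$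 there is exactly one singular point $s_j(\underline\epsilon)$ near $s_j$; it depends real analytically on $\underline\epsilon$, $s_j(\underline 0)=s_j$, and $\Re s_j(\underline\epsilon)\le1/2$. *)

theory Defs
  imports "HOL-Library.Function_Algebras" "HOL-Complex_Analysis.Complex_Analysis" "HOL-Homology.Homology" "HOL-Algebra.Algebra"
begin

section \<open>The group \<open>PSL\<^sub>2(\<real>)\<close> and its actions\<close>

definition SL2R :: "(real^2^2) monoid" where
  "SL2R = \<lparr>carrier = {A. det A = 1}, mult = (\<lambda>A B. A ** B), one = mat 1\<rparr>"

definition PSL2R :: "(real^2^2) set monoid" where
  "PSL2R = SL2R Mod {mat 1, - mat 1}"

text \<open>
  An element of \<^const>\<open>PSL2R\<close> is a pair \<open>{A, - A}\<close>.  Everything below that is computed from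
  a representative is unchanged when the representative changes sign.
\<close>

definition rep :: "(real^2^2) set \<Rightarrow> real^2^2" where
  "rep \<gamma> = (SOME A. A \<in> \<gamma>)"

definition uhp :: "complex set" where
  "uhp = {z. 0 < Im z}"

definition act :: "(real^2^2) set \<Rightarrow> complex \<Rightarrow> complex" where
  "act \<gamma> z = (of_real (rep \<gamma> $ 1 $ 1) * z + of_real (rep \<gamma> $ 1 $ 2)) /
             (of_real (rep \<gamma> $ 2 $ 1) * z + of_real (rep \<gamma> $ 2 $ 2))"

text \<open>The boundary \<open>\<real> \<union> {\<infinity>}\<close> is modelled by \<^typ>\<open>real option\<close>, with \<^const>\<open>None\<close> as \<open>\<infinity>\<close>.\<close>

definition boundary_act :: "(real^2^2) set \<Rightarrow> real option \<Rightarrow> real option" where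
  "boundary_act \<gamma> p =
    (let a = rep \<gamma> $ 1 $ 1; b = rep \<gamma> $ 1 $ 2; c = rep \<gamma> $ 2 $ 1; d = rep \<gamma> $ 2 $ 2 in
     case p of
       None \<Rightarrow> (if c = 0 then None else Some (a / c))
     | Some x \<Rightarrow> (if c * x + d = 0 then None else Some ((a * x + b) / (c * x + d))))"

section \<open>Discrete cofinite subgroups, cusps and the genus\<close>

text \<open>For \<open>\<Gamma> \<subseteq> PSL\<^sub>2(\<real>)\<close> the set \<open>\<Union>\<Gamma>\<close> is its full preimage in \<open>SL\<^sub>2(\<real>)\<close>.\<close>

definition discrete_subgroup :: "(real^2^2) set set \<Rightarrow> bool" where
  "discrete_subgroup \<Gamma> \<longleftrightarrow> subgroup \<Gamma> PSL2R \<and> discrete (\<Union>\<Gamma>)"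

definition hyperbolic_measure :: "complex measure" where
  "hyperbolic_measure =
     density lborel (\<lambda>z. ennreal (indicator uhp z / (Im z)\<^sup>2))"

definition fundamental_domain :: "(real^2^2) set set \<Rightarrow> complex set \<Rightarrow> bool" where
  "fundamental_domain \<Gamma> F \<longleftrightarrow>
     F \<in> sets borel \<and> F \<subseteq> uhp \<and>
     (\<forall>z\<in>uhp. \<exists>\<gamma>\<in>\<Gamma>. act \<gamma> z \<in> F) \<and>
     (\<forall>\<gamma>\<in>\<Gamma>. \<gamma> \<noteq> \<one>\<^bsub>PSL2R\<^esub> \<longrightarrow> act \<gamma> ` F \<inter> F \<in> null_sets hyperbolic_measure)"

definition cofinite_area :: "(real^2^2) set set \<Rightarrow> bool" where
  "cofinite_area \<Gamma> \<longleftrightarrow> (\<exists>F. fundamental_domain \<Gamma> F \<and> emeasure hyperbolic_measure F < \<infinity>)"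

definition parabolic :: "(real^2^2) set \<Rightarrow> bool" where
  "parabolic \<gamma> \<longleftrightarrow> \<gamma> \<noteq> \<one>\<^bsub>PSL2R\<^esub> \<and> \<bar>trace (rep \<gamma>)\<bar> = 2"

definition cusp_points :: "(real^2^2) set set \<Rightarrow> real option set" where
  "cusp_points \<Gamma> = {p. \<exists>\<gamma>\<in>\<Gamma>. parabolic \<gamma> \<and> boundary_act \<gamma> p = p}"

text \<open>The cusps are the \<open>\<Gamma>\<close>-orbits of \<^const>\<open>cusp_points\<close>; here there is only that of \<open>\<infinity>\<close>.\<close>

definition one_cusp_at_infinity :: "(real^2^2) set set \<Rightarrow> bool" where
  "one_cusp_at_infinity \<Gamma> \<longleftrightarrow> cusp_points \<Gamma> = (\<lambda>\<gamma>. boundary_act \<gamma> None) ` \<Gamma>"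

definition stabilizer_infinity :: "(real^2^2) set set \<Rightarrow> (real^2^2) set set" where
  "stabilizer_infinity \<Gamma> = {\<gamma>\<in>\<Gamma>. boundary_act \<gamma> None = None}"

definition unit_translation :: "(real^2^2) set" where
  "unit_translation =
     (let A = vector [vector [1, 1], vector [0, 1]] in {A, - A})"

definition orbit_of :: "(real^2^2) set set \<Rightarrow> complex \<Rightarrow> complex set" where
  "orbit_of \<Gamma> z = (\<lambda>\<gamma>. act \<gamma> z) ` \<Gamma>"

definition orbit_space :: "(real^2^2) set set \<Rightarrow> complex set topology" where
  "orbit_space \<Gamma> =
     topology (\<lambda>U. U \<subseteq> orbit_of \<Gamma> ` uhp \<and> openin (top_of_set uhp) {z\<in>uhp. orbit_of \<Gamma> z \<in> U})"

lemma openin_orbit_space: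
  "openin (orbit_space \<Gamma>) U \<longleftrightarrow>
     U \<subseteq> orbit_of \<Gamma> ` uhp \<and> openin (top_of_set uhp) {z\<in>uhp. orbit_of \<Gamma> z \<in> U}"
proof -
  let ?P = "\<lambda>U. {z\<in>uhp. orbit_of \<Gamma> z \<in> U}"
  let ?L = "\<lambda>U. U \<subseteq> orbit_of \<Gamma> ` uhp \<and> openin (top_of_set uhp) (?P U)"
  have "istopology ?L"
    unfolding istopology_def
  proof (intro conjI allI impI)
    fix S T assume "?L S" "?L T"
    moreover have "?P (S \<inter> T) = ?P S \<inter> ?P T" by auto
    ultimately show "openin (top_of_set uhp) (?P (S \<inter> T))" by auto
  next
    fix K assume "\<forall>S\<in>K. ?L S"
    moreover have "?P (\<Union>K) = (\<Union>S\<in>K. ?P S)" by auto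
    ultimately show "openin (top_of_set uhp) (?P (\<Union>K))" by auto
  qed auto
  then show ?thesis
    by (simp add: orbit_space_def topology_inverse')
qed

text \<open>
  When there is exactly one cusp, the compact surface obtained from \<open>\<Gamma>\<backslash>\<H>\<close> by adding it is the
  one-point compactification.  A closed oriented surface has genus \<open>g\<close> iff its first integral
  homology is free of rank \<open>2 g\<close>.
\<close>

definition compactified_quotient :: "(real^2^2) set set \<Rightarrow> complex set option topology" where
  "compactified_quotient \<Gamma> = Alexandroff_compactification (orbit_space \<Gamma>)"

definition has_genus :: "(real^2^2) set set \<Rightarrow> nat \<Rightarrow> bool" where
  "has_genus \<Gamma> g \<longleftrightarrow>
     homology_group 1 (compactified_quotient \<Gamma>) \<cong> free_Abelian_group {..<2 * g}"

definition reflection :: "complex \<Rightarrow> complex" where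
  "reflection z = - cnj z"

text \<open>\<open>T\<Gamma>T = \<Gamma>\<close>, as an equality of sets of self-maps of the upper half-plane.\<close>

definition reflection_invariant :: "(real^2^2) set set \<Rightarrow> bool" where
  "reflection_invariant \<Gamma> \<longleftrightarrow>
     (\<lambda>\<gamma>. restrict (reflection \<circ> act \<gamma> \<circ> reflection) uhp) ` \<Gamma> =
     (\<lambda>\<gamma>. restrict (act \<gamma>) uhp) ` \<Gamma>"

section \<open>Cusp forms of weight 2 and the character family\<close>

text \<open>
  For groups whose only cusp is \<open>\<infinity>\<close>, so that vanishing at the cusps means vanishing at \<open>\<infinity>\<close>.
\<close>

definition cusp_forms2 :: "(real^2^2) set set \<Rightarrow> (complex \<Rightarrow> complex) set" where
  "cusp_forms2 \<Gamma> =
     {f. f holomorphic_on uhp \<and>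
         (\<forall>\<gamma>\<in>\<Gamma>. \<forall>z\<in>uhp. f (act \<gamma> z) =
            (of_real (rep \<gamma> $ 2 $ 1) * z + of_real (rep \<gamma> $ 2 $ 2))\<^sup>2 * f z) \<and>
         (f \<longlongrightarrow> 0) (filtercomap Im at_top)}"

definition has_fourier_coefficients :: "(complex \<Rightarrow> complex) \<Rightarrow> (nat \<Rightarrow> complex) \<Rightarrow> bool" where
  "has_fourier_coefficients f a \<longleftrightarrow>
     (\<forall>z\<in>uhp. (\<lambda>n. a n * exp (2 * of_real pi * \<i> * of_nat n * z)) sums f z)"

text \<open>
  \<open>\<alpha>\<^sub>1 = Re (f dz)\<close> and \<open>\<alpha>\<^sub>2 = Im (f dz)\<close> are closed, so their integrals may be taken along the
  segment; along any path they are the real and imaginary part of \<open>\<integral> f dz\<close>.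
\<close>

definition alpha1_integral :: "(complex \<Rightarrow> complex) \<Rightarrow> complex \<Rightarrow> complex \<Rightarrow> real" where
  "alpha1_integral f z w = Re (contour_integral (linepath z w) f)"

definition alpha2_integral :: "(complex \<Rightarrow> complex) \<Rightarrow> complex \<Rightarrow> complex \<Rightarrow> real" where
  "alpha2_integral f z w = Im (contour_integral (linepath z w) f)"

definition character ::
  "(complex \<Rightarrow> complex) \<Rightarrow> complex \<Rightarrow> real \<times> real \<Rightarrow> (real^2^2) set \<Rightarrow> complex" where
  "character f z0 \<epsilon> \<gamma> =
     exp (- 2 * of_real pi * \<i> *
          of_real (fst \<epsilon> * alpha1_integral f z0 (act \<gamma> z0) +
                   snd \<epsilon> * alpha2_integral f z0 (act \<gamma> z0)))"

section \<open>The Laplacian and its eigenspaces\<close>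

definition partial_x :: "(complex \<Rightarrow> complex) \<Rightarrow> complex \<Rightarrow> complex" where
  "partial_x h z = vector_derivative (\<lambda>t. h (z + of_real t)) (at 0)"

definition partial_y :: "(complex \<Rightarrow> complex) \<Rightarrow> complex \<Rightarrow> complex" where
  "partial_y h z = vector_derivative (\<lambda>t. h (z + \<i> * of_real t)) (at 0)"

definition C1_uhp :: "(complex \<Rightarrow> complex) \<Rightarrow> bool" where
  "C1_uhp h \<longleftrightarrow>
     (\<forall>z\<in>uhp. (\<lambda>t::real. h (z + of_real t)) differentiable (at 0) \<and>
              (\<lambda>t::real. h (z + \<i> * of_real t)) differentiable (at 0)) \<and>
     continuous_on uhp (partial_x h) \<and> continuous_on uhp (partial_y h)"

definition C2_uhp :: "(complex \<Rightarrow> complex) \<Rightarrow> bool" where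
  "C2_uhp h \<longleftrightarrow> C1_uhp h \<and> C1_uhp (partial_x h) \<and> C1_uhp (partial_y h)"

definition hyperbolic_laplacian :: "(complex \<Rightarrow> complex) \<Rightarrow> complex \<Rightarrow> complex" where
  "hyperbolic_laplacian h z =
     of_real ((Im z)\<^sup>2) * (partial_x (partial_x h) z + partial_y (partial_y h) z)"

definition square_integrable_mod :: "(real^2^2) set set \<Rightarrow> (complex \<Rightarrow> complex) \<Rightarrow> bool" where
  "square_integrable_mod \<Gamma> h \<longleftrightarrow>
     (\<exists>F. fundamental_domain \<Gamma> F \<and>
          set_integrable hyperbolic_measure F (\<lambda>z. (cmod (h z))\<^sup>2))"

text \<open>
  The eigenspace for \<open>\<mu>\<close> of \<open>-\<Delta>\<close> on \<open>L\<^sup>2(\<Gamma>\<backslash>\<H>, \<psi>)\<close>, the functions with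
  \<open>h(\<gamma> z) = \<psi>(\<gamma>) h(z)\<close>.  By elliptic regularity an eigenfunction has a unique smooth
  representative, which solves the equation pointwise, and \<open>C\<^sup>2\<close> solutions are smooth.
  Elements are extended by \<open>0\<close> outside the upper half-plane so that they are determined there.
\<close>

definition eigenspace ::
  "(real^2^2) set set \<Rightarrow> ((real^2^2) set \<Rightarrow> complex) \<Rightarrow> complex \<Rightarrow> (complex \<Rightarrow> complex) set" where
  "eigenspace \<Gamma> \<psi> \<mu> =
     {h. (\<forall>z. z \<notin> uhp \<longrightarrow> h z = 0) \<and> C2_uhp h \<and>
         (\<forall>\<gamma>\<in>\<Gamma>. \<forall>z\<in>uhp. h (act \<gamma> z) = \<psi> \<gamma> * h z) \<and>
         square_integrable_mod \<Gamma> h \<and>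
         (\<forall>z\<in>uhp. - hyperbolic_laplacian h z = \<mu> * h z)}"

definition complex_dim :: "(complex \<Rightarrow> complex) set \<Rightarrow> nat" where
  "complex_dim V = vector_space.dim (\<lambda>c h z. c * h z) V"

definition simple_embedded_eigenvalue :: "(real^2^2) set set \<Rightarrow> complex \<Rightarrow> bool" where
  "simple_embedded_eigenvalue \<Gamma> s \<longleftrightarrow>
     complex_dim (eigenspace \<Gamma> (\<lambda>_. 1) (s * (1 - s))) = 1"

section \<open>Eisenstein series, the scattering function and singular points\<close>

definition cusp_cosets :: "(real^2^2) set set \<Rightarrow> (real^2^2) set set set" where
  "cusp_cosets \<Gamma> = rcosets\<^bsub>PSL2R\<lparr>carrier := \<Gamma>\<rparr>\<^esub> (stabilizer_infinity \<Gamma>)"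

definition eisenstein_term ::
  "((real^2^2) set \<Rightarrow> complex) \<Rightarrow> complex \<Rightarrow> complex \<Rightarrow> (real^2^2) set set \<Rightarrow> complex" where
  "eisenstein_term \<eta> z s C =
     (let \<gamma> = (SOME \<gamma>. \<gamma> \<in> C) in \<eta> \<gamma> * of_real (Im (act \<gamma> z)) powr s)"

text \<open>
  Meromorphy in \<open>s\<close> of a family indexed by the points of the upper half-plane, as a function with
  values in \<open>C(\<H>)\<close>: orders of poles are independent of \<open>z\<close> and the regular part is jointly
  continuous.
\<close>

definition meromorphic_family :: "(complex \<Rightarrow> complex \<Rightarrow> complex) \<Rightarrow> bool" where
  "meromorphic_family E \<longleftrightarrow>
     (\<forall>s0. \<exists>r>0. \<exists>n::nat. \<exists>G. continuous_on (uhp \<times> ball s0 r) (\<lambda>(z, s). G z s) \<and>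
        (\<forall>z\<in>uhp. G z holomorphic_on ball s0 r \<and>
           (\<forall>s\<in>ball s0 r - {s0}. (s - s0) ^ n * E z s = G z s)))"

text \<open>
  \<open>E\<close> is the meromorphic continuation of the Eisenstein series twisted by \<open>\<eta>\<close>, and \<open>\<phi>\<close> is the
  factor in its functional equation.  These conditions determine \<open>E\<close> and \<open>\<phi>\<close> up to their values
  on a sparse set of \<open>s\<close>.
\<close>

definition eisenstein_continuation ::
  "(real^2^2) set set \<Rightarrow> ((real^2^2) set \<Rightarrow> complex) \<Rightarrow>
   (complex \<Rightarrow> complex \<Rightarrow> complex) \<Rightarrow> (complex \<Rightarrow> complex) \<Rightarrow> bool" where
  "eisenstein_continuation \<Gamma> \<eta> E \<phi> \<longleftrightarrow>
     (\<forall>z\<in>uhp. \<forall>s. 1 < Re s \<longrightarrow> (eisenstein_term \<eta> z s has_sum E z s) (cusp_cosets \<Gamma>)) \<and>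
     meromorphic_family E \<and>
     \<phi> meromorphic_on UNIV \<and>
     (\<forall>\<^sub>\<approx>s\<in>UNIV. \<forall>z\<in>uhp. E z s = \<phi> s * E z (1 - s))"

definition resonance :: "(complex \<Rightarrow> complex) \<Rightarrow> complex \<Rightarrow> bool" where
  "resonance \<phi> s \<longleftrightarrow> Re s < 1/2 \<and> is_pole \<phi> s"

text \<open>
  Only singular points off the real axis are considered.  The argument \<open>\<eta>\<close> is the character in the
  Eisenstein series; the function space carries its conjugate.
\<close>

definition singular_point ::
  "(real^2^2) set set \<Rightarrow> ((real^2^2) set \<Rightarrow> complex) \<Rightarrow> (complex \<Rightarrow> complex) \<Rightarrow> complex \<Rightarrow> bool" where
  "singular_point \<Gamma> \<eta> \<phi> s \<longleftrightarrow> Im s \<noteq> 0 \<and>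
     (Re s = 1/2 \<and> eigenspace \<Gamma> (\<lambda>\<gamma>. cnj (\<eta> \<gamma>)) (s * (1 - s)) \<noteq> {\<lambda>_. 0} \<or> resonance \<phi> s)"

definition singular_multiplicity ::
  "(real^2^2) set set \<Rightarrow> ((real^2^2) set \<Rightarrow> complex) \<Rightarrow> (complex \<Rightarrow> complex) \<Rightarrow> complex \<Rightarrow> nat" where
  "singular_multiplicity \<Gamma> \<eta> \<phi> s =
     (if Re s = 1/2 then complex_dim (eigenspace \<Gamma> (\<lambda>\<gamma>. cnj (\<eta> \<gamma>)) (s * (1 - s)))
      else if resonance \<phi> s then nat (- zorder \<phi> s) else 0)"

definition real_analytic_at :: "(real \<times> real \<Rightarrow> complex) \<Rightarrow> real \<times> real \<Rightarrow> bool" where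
  "real_analytic_at F p \<longleftrightarrow>
     (\<exists>r>0. \<exists>c :: nat \<times> nat \<Rightarrow> complex. \<forall>u v. \<bar>u\<bar> < r \<and> \<bar>v\<bar> < r \<longrightarrow>
        ((\<lambda>(m, n). c (m, n) * of_real u ^ m * of_real v ^ n) has_sum F (p + (u, v))) UNIV)"

text \<open>
  \<open>S\<close> is the family of singular points, counted with multiplicity, into which \<open>s0\<close> moves
  under the family of characters \<open>\<eta>\<close> with scattering functions \<open>\<phi>\<close>.
\<close>

definition singular_point_branch ::
  "(real^2^2) set set \<Rightarrow> (real \<times> real \<Rightarrow> (real^2^2) set \<Rightarrow> complex) \<Rightarrow>
   (real \<times> real \<Rightarrow> complex \<Rightarrow> complex) \<Rightarrow> complex \<Rightarrow> (real \<times> real \<Rightarrow> complex) \<Rightarrow> bool" where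
  "singular_point_branch \<Gamma> \<eta> \<phi> s0 S \<longleftrightarrow>
     S (0, 0) = s0 \<and>
     (\<exists>r>0. \<exists>U. open U \<and> (0, 0) \<in> U \<and>
        (\<forall>\<epsilon>\<in>U. {s \<in> ball s0 r. singular_point \<Gamma> (\<eta> \<epsilon>) (\<phi> \<epsilon>) s} = {S \<epsilon>} \<and>
               singular_multiplicity \<Gamma> (\<eta> \<epsilon>) (\<phi> \<epsilon>) (S \<epsilon>) = 1 \<and>
               real_analytic_at S \<epsilon>))"

end

theory Submission
  imports Defs
begin

text \<open>
  Let \<open>Z\<close> be the set of small \<open>\<epsilon>\<close> with \<open>Re (S \<epsilon>) = 1/2\<close>, that is, those at which the singular point is
  still an embedded eigenvalue.  If \<open>h\<close> is an eigenfunction for \<open>\<epsilon> = (x, y)\<close>, then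
  \<open>z \<mapsto> cnj (h (- cnj z))\<close> is one for \<open>(x, - y)\<close> with the same real eigenvalue, because \<open>f\<close> has real Fourier
  coefficients; hence \<open>Z\<close> is symmetric in \<open>y\<close>.
  For \<open>u = Re S - 1/2 \<le> 0\<close> the second difference \<open>u (x, y) + u (x, - y) - 2 u (x, 0)\<close> equals \<open>y\<^sup>2 D (x, y)\<close>
  with \<open>D\<close> continuous and \<open>D (0, 0) = \<partial>\<^sub>2\<^sup>2 u (0, 0) < 0\<close>.  At a point of \<open>Z\<close> with \<open>y \<noteq> 0\<close> the left side is
  nonnegative, a contradiction, so near the origin \<open>Z\<close> lies on the axis \<open>y = 0\<close>, where the zeros of the
  nonconstant analytic function \<open>u (x, 0)\<close> are isolated.
\<close>

section \<open>Real power series in two variables\<close>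

text \<open>Termwise differentiation, twice. The iterated \<open>deriv\<close> depends only on the
  germ at 0, so \<open>g\<close> may be replaced by the series.\<close>

lemma deriv2_power_series_0:
  fixes a :: "nat \<Rightarrow> real"
  assumes "0 < \<rho>" and g: "\<And>y. \<bar>y\<bar> < \<rho> \<Longrightarrow> (\<lambda>n. a n * y ^ n) sums g y"
  shows "(deriv ^^ 2) g 0 = 2 * a 2"
proof -
  have sm: "summable (\<lambda>n. a n * y ^ n)" if "norm y < \<rho>" for y
    using g[of y] that by (auto simp: sums_iff)
  have sm': "summable (\<lambda>n. diffs a n * y ^ n)" if "norm y < \<rho>" for y
    by (rule termdiff_converges[OF that sm])
  have near: "\<forall>\<^sub>F y in nhds 0. \<bar>y::real\<bar> < \<rho>"
    using eventually_nhds_in_open[of "ball 0 \<rho>" "0::real"] \<open>0 < \<rho>\<close>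
    by (simp add: dist_real_def)
  have "\<forall>\<^sub>F y in nhds 0. g y = suminf (\<lambda>n. a n * y ^ n)"
    using near by eventually_elim (use g in \<open>simp add: sums_iff\<close>)
  then have "(deriv ^^ 2) g 0 = (deriv ^^ 2) (\<lambda>y. suminf (\<lambda>n. a n * y ^ n)) 0"
    by (intro higher_deriv_cong_ev refl)
  also have "\<dots> = deriv (deriv (\<lambda>y. suminf (\<lambda>n. a n * y ^ n))) 0"
    by (simp add: numeral_2_eq_2)
  also have "\<dots> = deriv (\<lambda>y. suminf (\<lambda>n. diffs a n * y ^ n)) 0"
  proof (rule deriv_cong_ev[OF _ refl])
    show "\<forall>\<^sub>F y in nhds 0. deriv (\<lambda>y. suminf (\<lambda>n. a n * y ^ n)) y = suminf (\<lambda>n. diffs a n * y ^ n)"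
      using near by eventually_elim (rule DERIV_imp_deriv[OF termdiffs_strong'[OF sm]], auto)
  qed
  also have "\<dots> = suminf (\<lambda>n. diffs (diffs a) n * 0 ^ n)"
    using \<open>0 < \<rho>\<close> by (intro DERIV_imp_deriv termdiffs_strong'[OF sm']) auto
  also have "\<dots> = diffs (diffs a) 0"
    by (rule powser_zero)
  also have "\<dots> = 2 * a 2"
    by (simp add: diffs_def numeral_2_eq_2)
  finally show ?thesis .
qed

text \<open>If all coefficients of positive degree vanished, \<open>g\<close> would be constant near
  0 and all its higher derivatives zero. Otherwise the zeros of \<open>g x - g 0\<close> are
  isolated, and the upper bound becomes strict off 0.\<close>

lemma power_series_eventually_less:
  fixes a :: "nat \<Rightarrow> real"
  assumes "0 < \<rho>" and g: "\<And>x. \<bar>x\<bar> < \<rho> \<Longrightarrow> (\<lambda>n. a n * x ^ n) sums g x"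
    and le: "\<forall>\<^sub>F x in nhds 0. g x \<le> g 0"
    and "l \<ge> 1" and "(deriv ^^ l) g 0 \<noteq> 0"
  shows "\<forall>\<^sub>F x in at 0. g x < g 0"
proof -
  have g0: "g 0 = a 0"
    using g[of 0] \<open>0 < \<rho>\<close> by (simp add: sums_iff powser_zero)
  have "\<exists>m>0. a m \<noteq> 0"
  proof (rule ccontr)
    assume "\<not> (\<exists>m>0. a m \<noteq> 0)"
    then have a: "a n = 0" if "n > 0" for n using that by blast
    have gx: "g x = a 0" if "\<bar>x\<bar> < \<rho>" for x
    proof -
      have "(\<lambda>n. a n * x ^ n) = (\<lambda>n. if n = 0 then a 0 else 0)"
        by (auto simp: fun_eq_iff a)
      then show ?thesis using g[OF that] sums_single[of 0 "\<lambda>_. a 0"] by (auto simp: sums_iff)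
    qed
    have "\<forall>\<^sub>F x in nhds 0. \<bar>x::real\<bar> < \<rho>"
      using eventually_nhds_in_open[of "ball 0 \<rho>" "0::real"] \<open>0 < \<rho>\<close>
      by (simp add: dist_real_def)
    then have "\<forall>\<^sub>F x in nhds 0. g x = a 0"
      by eventually_elim (rule gx)
    then have "(deriv ^^ l) g 0 = (deriv ^^ l) (\<lambda>_. a 0) 0"
      by (intro higher_deriv_cong_ev refl)
    also have "\<dots> = 0"
    proof -
      have "(deriv ^^ Suc k) (\<lambda>_. a 0) = (\<lambda>_. 0)" for k
        by (induction k) auto
      then show ?thesis using \<open>l \<ge> 1\<close> by (metis Suc_diff_1 less_le_trans zero_less_one)
    qed
    finally show False using assms by simp
  qed
  then obtain m where m: "m > 0" "a m \<noteq> 0" by blast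
  \<comment> \<open>Dropping the constant term gives the series of \<open>g x - g 0\<close>, which
    vanishes at 0 as the theorem on isolated zeros requires.\<close>
  define b where "b n = (if n = 0 then 0 else a n)" for n
  have b: "(\<lambda>n. b n * (x - 0) ^ n) sums (g x - g 0)" if "norm (x - 0) < \<rho>" for x
  proof -
    have "(\<lambda>n. a n * x ^ n - (if n = 0 then a 0 else 0)) sums (g x - a 0)"
      using that by (intro sums_diff g sums_single) auto
    also have "(\<lambda>n. a n * x ^ n - (if n = 0 then a 0 else 0)) = (\<lambda>n. b n * x ^ n)"
      by (auto simp: b_def)
    finally show ?thesis by (simp add: g0)
  qed
  obtain s where s: "0 < s" "\<And>x. x \<in> cball 0 s - {0} \<Longrightarrow> g x - g 0 \<noteq> 0"
    by (rule powser_0_nonzero[OF \<open>0 < \<rho>\<close> b, of m]) (use m in \<open>auto simp: b_def\<close>)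
  have "\<forall>\<^sub>F x in at 0. x \<in> ball 0 s - {0}"
    using \<open>0 < s\<close> by (intro eventually_at_in_open) auto
  moreover have "\<forall>\<^sub>F x in at 0. g x \<le> g 0"
    using le by (simp add: eventually_nhds_conv_at)
  ultimately show ?thesis
    by eventually_elim (use s in force)
qed

section \<open>Two-variable power series and second differences\<close>

text \<open>On an axis, terms with a positive power of the vanishing variable are zero, so the
  unordered sum reduces to one row of indices, where it may be read in the natural order.\<close>

lemma double_power_series_axes:
  fixes d :: "nat \<times> nat \<Rightarrow> real"
  assumes F: "((\<lambda>(m, n). d (m, n) * x ^ m * y ^ n) has_sum F) UNIV"
  shows double_power_series_axis1: "y = 0 \<Longrightarrow> (\<lambda>m. d (m, 0) * x ^ m) sums F"
    and double_power_series_axis2: "x = 0 \<Longrightarrow> (\<lambda>n. d (0, n) * y ^ n) sums F"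
proof -
  assume y: "y = 0"
  have "((\<lambda>(m, n). d (m, n) * x ^ m * y ^ n) has_sum F) (range (\<lambda>m. (m, 0)))"
    by (subst has_sum_cong_neutral[of UNIV]) (use F y in auto)
  then show "(\<lambda>m. d (m, 0) * x ^ m) sums F"
    by (subst (asm) has_sum_reindex) (auto simp: inj_on_def o_def intro: has_sum_imp_sums)
next
  assume x: "x = 0"
  have "((\<lambda>(m, n). d (m, n) * x ^ m * y ^ n) has_sum F) (range (\<lambda>n. (0, n)))"
    by (subst has_sum_cong_neutral[of UNIV]) (use F x in auto)
  then show "(\<lambda>n. d (0, n) * y ^ n) sums F"
    by (subst (asm) has_sum_reindex) (auto simp: inj_on_def o_def intro: has_sum_imp_sums)
qed

text \<open>In the second difference the terms of degree 0 and 1 in y cancel, so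
  \<open>y\<^sup>2\<close> can be divided out term by term. The quotient series converges uniformly
  on a smaller square, hence \<open>D\<close> is continuous; its value at the origin is the second
  y-derivative of \<open>F\<close> there.\<close>

lemma double_power_series_second_difference:
  fixes d :: "nat \<times> nat \<Rightarrow> real" and F :: "real \<times> real \<Rightarrow> real"
  assumes "0 < \<rho>"
    and F: "\<And>x y. \<bar>x\<bar> < \<rho> \<Longrightarrow> \<bar>y\<bar> < \<rho> \<Longrightarrow>
              ((\<lambda>(m, n). d (m, n) * x ^ m * y ^ n) has_sum F (x, y)) UNIV"
  obtains D where "(D \<longlongrightarrow> 2 * d (0, 2)) (nhds (0, 0))"
    and "\<forall>\<^sub>F (x, y) in nhds (0, 0). F (x, y) + F (x, - y) - 2 * F (x, 0) = y\<^sup>2 * D (x, y)"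
proof -
  \<comment> \<open>The terms of index \<open>(m, k + 2)\<close> at y and at -y, added and divided
    by \<open>y\<^sup>2\<close> in a form that also makes sense for y = 0.\<close>
  define t where "t = (\<lambda>(m, k) (x, y). d (m, k + 2) * x ^ m * (y ^ k + (- y) ^ k))"
  define D where "D = (\<lambda>p. \<Sum>\<^sub>\<infinity>q. t q p)"
  \<comment> \<open>Convergence at the corner \<open>(\<sigma>, \<sigma>)\<close>, strictly inside
    the domain, dominates the series on all of \<open>B\<close>.\<close>
  define \<sigma> where "\<sigma> = \<rho> / 2"
  define B where "B = {- \<sigma><..<\<sigma>} \<times> {- \<sigma><..<\<sigma>}"
  have \<sigma>: "0 < \<sigma>" "\<sigma> < \<rho>" using \<open>0 < \<rho>\<close> by (auto simp: \<sigma>_def)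
  have "open B" "(0, 0) \<in> B" using \<sigma> by (auto simp: B_def open_Times)
  \<comment> \<open>The factor \<open>2 / \<sigma>\<^sup>2\<close> compensates the index shift by 2,
    so that the majorant is a subfamily of the original series at the corner.\<close>
  have t_bound: "norm (t q p) \<le> (case q of (m, k) \<Rightarrow> 2 / \<sigma>\<^sup>2 * \<bar>d (m, k + 2) * \<sigma> ^ m * \<sigma> ^ (k + 2)\<bar>)"
    if "p \<in> B" for p q
  proof -
    obtain m k x y where qp: "q = (m, k)" "p = (x, y)" by (cases q, cases p)
    have xy: "\<bar>x\<bar> \<le> \<sigma>" "\<bar>y\<bar> \<le> \<sigma>" using that by (auto simp: B_def qp)
    have "\<bar>y ^ k + (- y) ^ k\<bar> \<le> \<bar>y\<bar> ^ k + \<bar>y\<bar> ^ k"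
      using abs_triangle_ineq[of "y ^ k" "(- y) ^ k"] by (simp add: power_abs)
    also have "\<dots> \<le> 2 * \<sigma> ^ k" using power_mono[OF xy(2), of k] by simp
    finally have "\<bar>d (m, k + 2)\<bar> * \<bar>x\<bar> ^ m * \<bar>y ^ k + (- y) ^ k\<bar> \<le> \<bar>d (m, k + 2)\<bar> * \<sigma> ^ m * (2 * \<sigma> ^ k)"
      using xy \<sigma> by (intro mult_mono power_mono) auto
    then show ?thesis
      using \<sigma> by (simp add: qp t_def abs_mult power_abs power_add power2_eq_square mult.assoc mult.left_commute)
  qed
  have "(\<lambda>(m, n). d (m, n) * \<sigma> ^ m * \<sigma> ^ n) summable_on UNIV"
    using F[of \<sigma> \<sigma>] \<sigma> by (auto simp: summable_on_def)
  then have "(\<lambda>q. \<bar>case q of (m, n) \<Rightarrow> d (m, n) * \<sigma> ^ m * \<sigma> ^ n\<bar>) summable_on UNIV"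
    by (subst (asm) summable_on_iff_abs_summable_on_real) simp
  then have "(\<lambda>q. \<bar>case q of (m, n) \<Rightarrow> d (m, n) * \<sigma> ^ m * \<sigma> ^ n\<bar>) summable_on range (\<lambda>(m, k). (m, k + 2))"
    by (rule summable_on_subset) simp
  then have sm: "(\<lambda>q. case q of (m, k) \<Rightarrow> 2 / \<sigma>\<^sup>2 * \<bar>d (m, k + 2) * \<sigma> ^ m * \<sigma> ^ (k + 2)\<bar>) summable_on UNIV"
    by (subst (asm) summable_on_reindex)
       (auto simp: inj_on_def o_def case_prod_unfold simp del: times_divide_eq_left intro!: summable_on_cmult_right)
  have ul: "uniform_limit B (\<lambda>Q p. \<Sum>q\<in>Q. t q p) D (finite_subsets_at_top UNIV)"
    unfolding D_def by (rule Weierstrass_m_test_general[OF t_bound sm])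
  have t_cont: "continuous_on B (t q)" for q
    by (auto simp: t_def case_prod_unfold intro!: continuous_intros)
  have "continuous_on B D"
    by (rule uniform_limit_theorem[OF _ ul]) (auto intro!: always_eventually continuous_on_sum t_cont)
  then have "isCont D (0, 0)"
    using \<open>open B\<close> \<open>(0, 0) \<in> B\<close> by (simp add: continuous_on_eq_continuous_at)
  then have lim: "(D \<longlongrightarrow> D (0, 0)) (nhds (0, 0))"
    by (rule isCont_tendsto_compose) (rule filterlim_ident)
  \<comment> \<open>At the origin only the index (0, 0) survives, where both powers
    \<open>0 ^ 0\<close> equal 1.\<close>
  have "D (0, 0) = (\<Sum>\<^sub>\<infinity>q\<in>{(0, 0)}. t q (0, 0))"
    unfolding D_def by (rule infsum_cong_neutral) (auto simp: t_def)
  then have D0: "D (0, 0) = 2 * d (0, 2)" by (simp add: t_def numeral_2_eq_2)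
  have diff: "F (x, y) + F (x, - y) - 2 * F (x, 0) = y\<^sup>2 * D (x, y)" if "(x, y) \<in> B" for x y
  proof -
    have xy: "\<bar>x\<bar> < \<rho>" "\<bar>y\<bar> < \<rho>" using that \<sigma> by (auto simp: B_def)
    have "((\<lambda>q. (case q of (m, n) \<Rightarrow> d (m, n) * x ^ m * y ^ n)
              + (case q of (m, n) \<Rightarrow> d (m, n) * x ^ m * (- y) ^ n)
              + (- 2) * (case q of (m, n) \<Rightarrow> d (m, n) * x ^ m * 0 ^ n))
            has_sum (F (x, y) + F (x, - y) + (- 2) * F (x, 0))) UNIV"
      using xy \<open>0 < \<rho>\<close> by (intro has_sum_add has_sum_cmult_right F) auto
    also have "?this \<longleftrightarrow>
        ((\<lambda>(m, n). d (m, n) * x ^ m * (y ^ n + (- y) ^ n)) has_sum (F (x, y) + F (x, - y) + (- 2) * F (x, 0)))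
          (range (\<lambda>(m, k). (m, k + 2)))"
    \<comment> \<open>For n = 0 the terms cancel as 1 + 1 - 2, since \<open>0 ^ 0 = 1\<close>; for n
      = 1 they cancel by oddness. For n at least 2 the third series contributes nothing.\<close>
    proof (rule has_sum_cong_neutral)
      fix q :: "nat \<times> nat" assume "q \<in> UNIV - range (\<lambda>(m, k). (m, k + 2))"
      moreover obtain m n where q: "q = (m, n)" by (cases q)
      moreover have "q \<in> range (\<lambda>(m, k). (m, k + 2))" if "n \<ge> 2"
        using that by (intro range_eqI[of _ _ "(m, n - 2)"]) (simp add: q)
      ultimately have "\<not> n \<ge> 2" by blast
      then have "n = 0 \<or> n = 1" by auto
      then show "(case q of (m, n) \<Rightarrow> d (m, n) * x ^ m * y ^ n)
              + (case q of (m, n) \<Rightarrow> d (m, n) * x ^ m * (- y) ^ n)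
              + (- 2) * (case q of (m, n) \<Rightarrow> d (m, n) * x ^ m * 0 ^ n) = 0"
        by (auto simp: q)
    qed (auto simp: algebra_simps)
    also have "\<dots> \<longleftrightarrow> ((\<lambda>q. y\<^sup>2 * t q (x, y)) has_sum (F (x, y) + F (x, - y) + (- 2) * F (x, 0))) UNIV"
      by (subst has_sum_reindex)
         (auto simp: inj_on_def o_def case_prod_unfold t_def algebra_simps power2_eq_square
               intro!: has_sum_cong)
    finally have "F (x, y) + F (x, - y) + (- 2) * F (x, 0) = (\<Sum>\<^sub>\<infinity>q. y\<^sup>2 * t q (x, y))"
      by (simp add: infsumI)
    also have "\<dots> = y\<^sup>2 * D (x, y)"
      unfolding D_def by (rule infsum_cmult_right')
    finally show ?thesis by simp
  qed
  have "\<forall>\<^sub>F p in nhds (0, 0). p \<in> B"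
    using \<open>open B\<close> \<open>(0, 0) \<in> B\<close> by (rule eventually_nhds_in_open)
  then have "\<forall>\<^sub>F (x, y) in nhds (0, 0). F (x, y) + F (x, - y) - 2 * F (x, 0) = y\<^sup>2 * D (x, y)"
    by eventually_elim (use diff in auto)
  with lim D0 that show thesis by simp
qed

text \<open>Assumption \<open>sym\<close> asks for symmetry of the set where the maximum is
  attained, not for \<open>F\<close> to be even in y: the second difference is evaluated with both
  outer points in that set.\<close>

lemma double_power_series_eventually_less:
  fixes d :: "nat \<times> nat \<Rightarrow> real" and F :: "real \<times> real \<Rightarrow> real"
  assumes "0 < \<rho>"
    and F: "\<And>x y. \<bar>x\<bar> < \<rho> \<Longrightarrow> \<bar>y\<bar> < \<rho> \<Longrightarrow>
              ((\<lambda>(m, n). d (m, n) * x ^ m * y ^ n) has_sum F (x, y)) UNIV"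
    and le: "\<forall>\<^sub>F p in nhds (0, 0). F p \<le> F (0, 0)"
    and sym: "\<forall>\<^sub>F (x, y) in nhds (0, 0). F (x, y) = F (0, 0) \<longrightarrow> F (x, - y) = F (0, 0)"
    and d2: "(deriv ^^ 2) (\<lambda>y. F (0, y)) 0 \<noteq> 0"
    and "l \<ge> 1" and dl: "(deriv ^^ l) (\<lambda>x. F (x, 0)) 0 \<noteq> 0"
  shows "\<forall>\<^sub>F p in at (0, 0). F p < F (0, 0)"
proof -
  obtain D where lim: "(D \<longlongrightarrow> 2 * d (0, 2)) (nhds (0, 0))"
    and diff: "\<forall>\<^sub>F (x, y) in nhds (0, 0). F (x, y) + F (x, - y) - 2 * F (x, 0) = y\<^sup>2 * D (x, y)"
    using double_power_series_second_difference[of \<rho> d F] assms(1) F by blast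
  have axis2: "filterlim (\<lambda>y. (0, y)) (nhds (0, 0)) (nhds (0::real))" and
       axis2_neg: "filterlim (\<lambda>y. (0, - y)) (nhds (0, 0)) (nhds (0::real))" and
       axis1: "filterlim (\<lambda>x. (x, 0)) (nhds (0, 0)) (nhds (0::real))" and
       proj: "filterlim (\<lambda>p. (fst p, 0)) (nhds (0, 0)) (nhds (0::real, 0::real))" and
       fst0: "filterlim fst (nhds 0) (nhds (0::real, 0::real))"
    by (auto intro!: tendsto_eq_intros filterlim_ident)
  have le2: "\<forall>\<^sub>F y in nhds 0. F (0, y) \<le> F (0, 0)" "\<forall>\<^sub>F y in nhds 0. F (0, - y) \<le> F (0, 0)"
    using eventually_compose_filterlim[OF le axis2] eventually_compose_filterlim[OF le axis2_neg] by auto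
  have "\<forall>\<^sub>F y in nhds 0. F (0, y) + F (0, - y) - 2 * F (0, 0) = y\<^sup>2 * D (0, y)"
    using eventually_compose_filterlim[OF diff axis2] by simp
  \<comment> \<open>Along x = 0 the second difference is nonpositive; dividing by
    \<open>y\<^sup>2\<close> and letting y tend to 0 shows that \<open>d (0, 2)\<close> is
    nonpositive, and \<open>d2\<close> excludes 0.\<close>
  with le2 have "\<forall>\<^sub>F y in nhds 0. y \<noteq> 0 \<longrightarrow> D (0, y) \<le> 0"
    by eventually_elim (smt (verit) mult_pos_pos zero_less_power2)
  then have "\<forall>\<^sub>F y in at 0. D (0, y) \<le> 0"
    by (simp add: eventually_at_filter)
  moreover have "((\<lambda>y. D (0, y)) \<longlongrightarrow> 2 * d (0, 2)) (at 0)"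
    using filterlim_compose[OF lim axis2] by (rule tendsto_mono[rotated]) (simp add: at_within_def)
  ultimately have "2 * d (0, 2) \<le> 0"
    by (intro tendsto_upperbound) auto
  moreover have "(deriv ^^ 2) (\<lambda>y. F (0, y)) 0 = 2 * d (0, 2)"
    using deriv2_power_series_0[of \<rho> "\<lambda>n. d (0, n)" "\<lambda>y. F (0, y)"] assms(1)
          double_power_series_axis2[OF F] by simp
  ultimately have "2 * d (0, 2) < 0" using d2 by simp
  then have D_neg: "\<forall>\<^sub>F p in nhds (0, 0). D p < 0"
    using lim by (rule order_tendstoD(2)[rotated])
  have "\<forall>\<^sub>F x in at 0. F (x, 0) < F (0, 0)"
    using power_series_eventually_less[of \<rho> "\<lambda>m. d (m, 0)" "\<lambda>x. F (x, 0)" l] assms(1) \<open>l \<ge> 1\<close> dl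
          double_power_series_axis1[OF F] eventually_compose_filterlim[OF le axis1] by simp
  then have "\<forall>\<^sub>F x in nhds 0. x \<noteq> 0 \<longrightarrow> F (x, 0) < F (0, 0)"
    by (simp add: eventually_at_filter)
  \<comment> \<open>Pulled back along the projection to the first axis, the one-variable statement
    can be combined with the others at a common point p.\<close>
  then have less1: "\<forall>\<^sub>F p in nhds (0::real, 0::real). fst p \<noteq> 0 \<longrightarrow> F (fst p, 0) < F (0, 0)"
    using fst0 by (rule eventually_compose_filterlim)
  have le1: "\<forall>\<^sub>F p in nhds (0::real, 0::real). F (fst p, 0) \<le> F (0, 0)"
    using eventually_compose_filterlim[OF le proj] by simp
  have "\<forall>\<^sub>F p in nhds (0, 0). p \<noteq> (0, 0) \<longrightarrow> F p < F (0, 0)"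
    using le sym diff D_neg less1 le1
  proof eventually_elim
    case (elim p)
    obtain x y where p: "p = (x, y)" by (cases p)
    show ?case
    proof (intro impI, rule ccontr)
      assume "p \<noteq> (0, 0)" "\<not> F p < F (0, 0)"
      then have eq: "F (x, y) = F (0, 0)" "F (x, - y) = F (0, 0)" using elim p by auto
      show False
      proof (cases "y = 0")
        case True
        then show False using \<open>p \<noteq> (0, 0)\<close> eq elim p by auto
      next
        case False
        \<comment> \<open>With both outer values maximal, the second difference is
          \<open>2 * F (0, 0) - 2 * F (x, 0)\<close>, which \<open>le1\<close> makes
          nonnegative.\<close>
        then have "y\<^sup>2 * D (x, y) < 0" using elim(4) p by (simp add: mult_pos_neg)
        then show False using eq elim(3,6) p by simp
      qed
    qed
  qed
  then show ?thesis by (simp add: eventually_at_filter)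
qed

section \<open>The reflection and the eigenspaces\<close>

text \<open>\<open>rep\<close> is an arbitrary choice between A and -A; in even dimension the
  determinant does not see the sign.\<close>

lemma carrier_PSL2R_rep:
  assumes "\<gamma> \<in> carrier PSL2R"
  shows "det (rep \<gamma>) = 1" "\<gamma> = {rep \<gamma>, - rep \<gamma>}"
proof -
  have neg: "(- mat 1) ** A = - A" for A :: "real^2^2"
    by (simp add: vec_eq_iff matrix_matrix_mult_def mat_def forall_2 sum_2)
  obtain A where A: "det A = 1" "\<gamma> = {A, - A}"
    using assms by (auto simp: PSL2R_def FactGroup_def RCOSETS_def r_coset_def SL2R_def neg)
  have "rep \<gamma> \<in> \<gamma>"
    unfolding rep_def by (rule someI[of _ A]) (simp add: A(2))
  then have "rep \<gamma> = A \<or> rep \<gamma> = - A"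
    unfolding A(2) by blast
  then have "det (rep \<gamma>) = det A" "{rep \<gamma>, - rep \<gamma>} = {A, - A}"
    by (auto simp: det_2)
  with A show "det (rep \<gamma>) = 1" "\<gamma> = {rep \<gamma>, - rep \<gamma>}"
    by (simp_all only:)
qed

lemma one_PSL2R: "\<one>\<^bsub>PSL2R\<^esub> = {mat 1, - mat 1}"
  by (simp add: PSL2R_def FactGroup_def)

lemma det_rep_eq:
  assumes "\<gamma> \<in> carrier PSL2R"
  shows "rep \<gamma> $ 1 $ 1 * rep \<gamma> $ 2 $ 2 - rep \<gamma> $ 1 $ 2 * rep \<gamma> $ 2 $ 1 = 1"
  using carrier_PSL2R_rep(1)[OF assms] by (simp add: det_2)

lemma act_denominator_nonzero:
  assumes "\<gamma> \<in> carrier PSL2R" "z \<in> uhp"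
  shows "of_real (rep \<gamma> $ 2 $ 1) * z + of_real (rep \<gamma> $ 2 $ 2) \<noteq> 0"
proof
  assume eq: "of_real (rep \<gamma> $ 2 $ 1) * z + of_real (rep \<gamma> $ 2 $ 2) = 0"
  have "rep \<gamma> $ 2 $ 1 * Im z = 0" "rep \<gamma> $ 2 $ 1 * Re z + rep \<gamma> $ 2 $ 2 = 0"
    using arg_cong[OF eq, of Im] arg_cong[OF eq, of Re] by simp_all
  then have "rep \<gamma> $ 2 $ 1 = 0" "rep \<gamma> $ 2 $ 2 = 0"
    using assms(2) by (auto simp: uhp_def)
  then show False using det_rep_eq[OF assms(1)] by simp
qed

text \<open>The derivative is the reciprocal of the weight 2 factor in \<open>cusp_forms2\<close>,
  which makes f dz invariant under the group.\<close>

lemma DERIV_act: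
  assumes "\<gamma> \<in> carrier PSL2R" "z \<in> uhp"
  shows "(act \<gamma> has_field_derivative
          1 / (of_real (rep \<gamma> $ 2 $ 1) * z + of_real (rep \<gamma> $ 2 $ 2))\<^sup>2) (at z)"
proof -
  have det: "complex_of_real (rep \<gamma> $ 1 $ 1) * of_real (rep \<gamma> $ 2 $ 2)
      - of_real (rep \<gamma> $ 1 $ 2) * of_real (rep \<gamma> $ 2 $ 1) = 1"
    using arg_cong[OF det_rep_eq[OF assms(1)], of complex_of_real] by simp
  have "act \<gamma> = (\<lambda>z. (of_real (rep \<gamma> $ 1 $ 1) * z + of_real (rep \<gamma> $ 1 $ 2)) /
             (of_real (rep \<gamma> $ 2 $ 1) * z + of_real (rep \<gamma> $ 2 $ 2)))"
    by (simp add: act_def fun_eq_iff)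
  then show ?thesis
    using act_denominator_nonzero[OF assms] det
    by (auto intro!: derivative_eq_intros simp: power2_eq_square algebra_simps)
qed

lemma act_uhp:
  assumes "\<gamma> \<in> carrier PSL2R" "z \<in> uhp"
  shows "act \<gamma> z \<in> uhp"
proof -
  let ?a = "rep \<gamma> $ 1 $ 1" and ?b = "rep \<gamma> $ 1 $ 2" and ?c = "rep \<gamma> $ 2 $ 1" and ?d = "rep \<gamma> $ 2 $ 2"
  let ?w = "of_real ?c * z + of_real ?d"
  \<comment> \<open>The left side is the imaginary part of (az + b) times the conjugate of cz +
    d.\<close>
  have "(?a * Im z) * (?c * Re z + ?d) - (?a * Re z + ?b) * (?c * Im z) = Im z * (?a * ?d - ?b * ?c)"
    by (simp add: algebra_simps)
  then have "Im (act \<gamma> z) = Im z / (cmod ?w)\<^sup>2"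
    by (simp add: act_def Im_divide cmod_power2 det_rep_eq[OF assms(1)])
  then show ?thesis
    using act_denominator_nonzero[OF assms] assms(2) by (simp add: uhp_def)
qed

text \<open>Faithfulness of the action; it ensures that conjugation by the reflection keeps
  nontrivial elements nontrivial.\<close>

lemma act_trivial_imp_one:
  assumes "\<gamma> \<in> carrier PSL2R" "\<And>z. z \<in> uhp \<Longrightarrow> act \<gamma> z = z"
  shows "\<gamma> = \<one>\<^bsub>PSL2R\<^esub>"
proof -
  let ?A = "rep \<gamma>"
  have eq: "of_real (?A $ 1 $ 1) * z + of_real (?A $ 1 $ 2) =
        z * (of_real (?A $ 2 $ 1) * z + of_real (?A $ 2 $ 2))" if "z \<in> uhp" for z
    using assms(2)[OF that] act_denominator_nonzero[OF assms(1) that] by (simp add: act_def divide_eq_eq)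
  \<comment> \<open>The points i and 2i suffice: they give b = -c and b = -4c, hence b = c = 0,
    together with a = d.\<close>
  have "?A $ 1 $ 2 = - (?A $ 2 $ 1)" "?A $ 1 $ 1 = ?A $ 2 $ 2" "?A $ 1 $ 2 = - 4 * (?A $ 2 $ 1)"
    using eq[of \<i>] eq[of "2 * \<i>"] by (simp_all add: uhp_def complex_eq_iff)
  then have entries: "?A $ 1 $ 2 = 0" "?A $ 2 $ 1 = 0" "?A $ 1 $ 1 = ?A $ 2 $ 2" by simp_all
  then have "(?A $ 2 $ 2)\<^sup>2 = 1"
    using det_rep_eq[OF assms(1)] by (simp add: power2_eq_square)
  then have "?A $ 2 $ 2 = 1 \<or> ?A $ 2 $ 2 = - 1"
    by (simp add: power2_eq_1_iff)
  then have "?A = mat 1 \<or> ?A = - mat 1"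
    using entries by (auto simp: vec_eq_iff mat_def forall_2)
  then show ?thesis
    using carrier_PSL2R_rep(2)[OF assms(1)] one_PSL2R by auto
qed

section \<open>The reflection and the hyperbolic measure\<close>

lemma open_uhp: "open uhp"
  unfolding uhp_def by (rule open_halfspace_Im_gt)

lemma convex_uhp: "convex uhp"
  unfolding uhp_def by (rule convex_halfspace_Im_gt)

lemma reflection_reflection [simp]: "reflection (reflection z) = z"
  by (simp add: reflection_def)

lemma reflection_in_uhp_iff [simp]: "reflection z \<in> uhp \<longleftrightarrow> z \<in> uhp"
  by (simp add: reflection_def uhp_def)

lemma reflection_image_eq_vimage: "reflection ` A = reflection -` A"
proof
  show "reflection -` A \<subseteq> reflection ` A"
  proof
    fix z assume "z \<in> reflection -` A"
    then show "z \<in> reflection ` A" by (intro image_eqI[of _ _ "reflection z"]) auto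
  qed
qed auto

lemma continuous_on_reflection: "continuous_on A reflection"
  unfolding reflection_def by (intro continuous_intros)

lemma reflection_measurable [measurable]: "reflection \<in> borel_measurable borel"
  by (intro borel_measurable_continuous_onI continuous_on_reflection)

lemma reflection_measurable_hyperbolic: "reflection \<in> measurable hyperbolic_measure borel"
  by (simp add: hyperbolic_measure_def)

lemma space_hyperbolic_measure: "space hyperbolic_measure = UNIV"
  by (simp add: hyperbolic_measure_def)

text \<open>In the basis 1, i the reflection is diagonal with entries -1 and 1, so its Jacobian has
  modulus 1.\<close>

lemma distr_lborel_reflection: "distr lborel borel reflection = lborel"
proof -
  have T: "reflection x = 0 + (\<Sum>j\<in>Basis. ((if j = 1 then - 1 else 1) * (x \<bullet> j)) *\<^sub>R j)" for x
    by (simp add: Basis_complex_def reflection_def complex_eq_iff)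
  show ?thesis
    using lborel_affine_euclidean[of "\<lambda>j. if j = 1 then - 1 else 1" "0::complex", folded T]
    by (simp add: density_1 Basis_complex_def)
qed

text \<open>The density depends on Im z alone, which the reflection preserves.\<close>

lemma distr_hyperbolic_reflection: "distr hyperbolic_measure borel reflection = hyperbolic_measure"
proof (rule measure_eqI)
  fix A assume "A \<in> sets (distr hyperbolic_measure borel reflection)"
  then have A [measurable]: "A \<in> sets borel" by simp
  let ?w = "\<lambda>z. ennreal (indicator uhp z / (Im z)\<^sup>2)"
  have [measurable]: "uhp \<in> sets borel" using open_uhp by simp
  have "emeasure (distr hyperbolic_measure borel reflection) A
      = (\<integral>\<^sup>+z. ?w z * indicator (reflection -` A) z \<partial>lborel)"
    by (simp add: emeasure_distr hyperbolic_measure_def emeasure_density measurable_sets_borel[OF reflection_measurable A])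
  also have "\<dots> = (\<integral>\<^sup>+z. ?w (reflection z) * indicator A (reflection z) \<partial>lborel)"
    by (intro nn_integral_cong) (auto simp: indicator_def reflection_def uhp_def)
  also have "\<dots> = (\<integral>\<^sup>+z. ?w z * indicator A z \<partial>distr lborel borel reflection)"
    by (subst nn_integral_distr) auto
  also have "\<dots> = emeasure hyperbolic_measure A"
    by (simp add: distr_lborel_reflection hyperbolic_measure_def emeasure_density)
  finally show "emeasure (distr hyperbolic_measure borel reflection) A = emeasure hyperbolic_measure A" .
qed (simp add: hyperbolic_measure_def)

text \<open>\<open>\<gamma>'\<close> plays the role of T\<gamma>T. It is described by its action
  because the invariance hypothesis compares maps.\<close>

lemma reflection_conjugate:
  assumes "reflection_invariant \<Gamma>" "\<gamma> \<in> \<Gamma>"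
  obtains \<gamma>' where "\<gamma>' \<in> \<Gamma>" "\<And>z. z \<in> uhp \<Longrightarrow> reflection (act \<gamma> z) = act \<gamma>' (reflection z)"
proof -
  have "restrict (reflection \<circ> act \<gamma> \<circ> reflection) uhp \<in> (\<lambda>\<gamma>. restrict (act \<gamma>) uhp) ` \<Gamma>"
    using assms by (auto simp: reflection_invariant_def)
  then obtain \<gamma>' where "\<gamma>' \<in> \<Gamma>"
    and eq: "restrict (reflection \<circ> act \<gamma> \<circ> reflection) uhp = restrict (act \<gamma>') uhp"
    by auto
  moreover have "reflection (act \<gamma> z) = act \<gamma>' (reflection z)" if "z \<in> uhp" for z
    using fun_cong[OF eq, of "reflection z"] that by simp
  ultimately show thesis using that by blast
qed

section \<open>Reflected fundamental domains and square integrability\<close>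

text \<open>\<open>square_integrable_mod\<close> asks for some fundamental domain; for a reflected
  function the reflected domain serves.\<close>

lemma fundamental_domain_reflection:
  assumes "\<Gamma> \<subseteq> carrier PSL2R" "reflection_invariant \<Gamma>" "fundamental_domain \<Gamma> F"
  shows "fundamental_domain \<Gamma> (reflection ` F)"
  unfolding fundamental_domain_def
proof (intro conjI ballI impI)
  have F: "F \<in> sets borel" "F \<subseteq> uhp" using assms by (auto simp: fundamental_domain_def)
  show "reflection ` F \<in> sets borel"
    unfolding reflection_image_eq_vimage by (rule measurable_sets_borel[OF reflection_measurable F(1)])
  show "reflection ` F \<subseteq> uhp" using F by auto
next
  fix z assume z: "z \<in> uhp"
  then obtain \<gamma> where "\<gamma> \<in> \<Gamma>" and F: "act \<gamma> (reflection z) \<in> F"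
    using assms(3) by (metis fundamental_domain_def reflection_in_uhp_iff)
  then obtain \<gamma>' where "\<gamma>' \<in> \<Gamma>" "\<And>z. z \<in> uhp \<Longrightarrow> reflection (act \<gamma> z) = act \<gamma>' (reflection z)"
    using reflection_conjugate[OF assms(2)] by blast
  then have "\<gamma>' \<in> \<Gamma>" "act \<gamma>' z = reflection (act \<gamma> (reflection z))"
    using z by simp_all
  with F show "\<exists>\<gamma>\<in>\<Gamma>. act \<gamma> z \<in> reflection ` F" by auto
next
  have F: "F \<subseteq> uhp" using assms by (auto simp: fundamental_domain_def)
  fix \<gamma> assume \<gamma>: "\<gamma> \<in> \<Gamma>" "\<gamma> \<noteq> \<one>\<^bsub>PSL2R\<^esub>"
  then obtain \<gamma>' where \<gamma>': "\<gamma>' \<in> \<Gamma>" "\<And>z. z \<in> uhp \<Longrightarrow> reflection (act \<gamma> z) = act \<gamma>' (reflection z)"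
    using reflection_conjugate[OF assms(2)] by blast
  \<comment> \<open>The null set condition covers nontrivial elements only. If
    \<open>\<gamma>'\<close> were the identity, \<open>\<gamma>\<close> would fix every point and be
    the identity by faithfulness.\<close>
  have "\<gamma>' \<noteq> \<one>\<^bsub>PSL2R\<^esub>"
  proof
    assume one: "\<gamma>' = \<one>\<^bsub>PSL2R\<^esub>"
    have "rep \<gamma>' \<in> {mat 1, - mat 1}"
      unfolding one rep_def one_PSL2R by (rule someI[of _ "mat 1"]) simp
    then have "act \<gamma>' z = z" for z by (auto simp: act_def mat_def)
    then have "reflection (act \<gamma> z) = reflection z" if "z \<in> uhp" for z
      using \<gamma>'(2)[OF that] by simp
    then have "act \<gamma> z = z" if "z \<in> uhp" for z
      using that by (metis reflection_reflection)
    then show False using act_trivial_imp_one \<gamma> assms(1) by blast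
  qed
  then have null: "act \<gamma>' ` F \<inter> F \<in> null_sets hyperbolic_measure"
    using assms \<gamma>' by (auto simp: fundamental_domain_def)
  \<comment> \<open>Overlaps of the reflected domain under \<open>\<gamma>\<close> are reflections
    of overlaps of \<open>F\<close> under \<open>\<gamma>'\<close>, hence null by invariance of the
    measure.\<close>
  have "act \<gamma> ` reflection ` F = reflection ` act \<gamma>' ` F"
    unfolding image_image
  proof (rule image_cong)
    fix z assume "z \<in> F"
    then show "act \<gamma> (reflection z) = reflection (act \<gamma>' z)"
      using \<gamma>'(2)[of "reflection z"] F by (metis reflection_reflection reflection_in_uhp_iff subsetD)
  qed simp
  then have eq: "act \<gamma> ` reflection ` F \<inter> reflection ` F = reflection -` (act \<gamma>' ` F \<inter> F)"
    by (simp only: reflection_image_eq_vimage vimage_Int)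
  have "act \<gamma>' ` F \<inter> F \<in> null_sets (distr hyperbolic_measure borel reflection)"
    unfolding distr_hyperbolic_reflection by (rule null)
  then have "reflection -` (act \<gamma>' ` F \<inter> F) \<inter> space hyperbolic_measure \<in> null_sets hyperbolic_measure"
    unfolding null_sets_distr_iff[OF reflection_measurable_hyperbolic] by (rule conjunct1)
  then show "act \<gamma> ` reflection ` F \<inter> reflection ` F \<in> null_sets hyperbolic_measure"
    unfolding eq space_hyperbolic_measure Int_UNIV_right .
qed

lemma square_integrable_mod_reflection:
  assumes "\<Gamma> \<subseteq> carrier PSL2R" "reflection_invariant \<Gamma>" "square_integrable_mod \<Gamma> h"
  shows "square_integrable_mod \<Gamma> (\<lambda>z. cnj (h (reflection z)))"
proof -
  obtain F where F: "fundamental_domain \<Gamma> F"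
    and int: "set_integrable hyperbolic_measure F (\<lambda>z. (cmod (h z))\<^sup>2)"
    using assms(3) by (auto simp: square_integrable_mod_def)
  have "integrable hyperbolic_measure (\<lambda>z. indicator F (reflection z) *\<^sub>R (cmod (h (reflection z)))\<^sup>2)"
    using int distr_hyperbolic_reflection unfolding set_integrable_def
    by (intro integrable_distr[OF reflection_measurable_hyperbolic]) simp
  also have "(\<lambda>z. indicator F (reflection z)) = (indicator (reflection ` F) :: complex \<Rightarrow> real)"
    by (auto simp: reflection_image_eq_vimage indicator_def fun_eq_iff)
  finally have "set_integrable hyperbolic_measure (reflection ` F) (\<lambda>z. (cmod (cnj (h (reflection z))))\<^sup>2)"
    by (simp add: set_integrable_def)
  then show ?thesis
    using fundamental_domain_reflection[OF assms(1,2) F] by (auto simp: square_integrable_mod_def)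
qed

section \<open>The Laplacian and its eigenspaces under the reflection\<close>

text \<open>The scalar \<open>c\<close> allows iteration: differentiating in x turns c into -c, so
  the lemma applies again to the first derivatives. The formula for \<open>g\<close> is required on
  \<open>uhp\<close> only, since that is where the derivative formulas hold.\<close>

lemma C1_uhp_reflection:
  assumes h: "C1_uhp h" and g: "\<And>z. z \<in> uhp \<Longrightarrow> g z = c * cnj (h (reflection z))"
  shows "C1_uhp g"
    and "\<And>z. z \<in> uhp \<Longrightarrow> partial_x g z = - c * cnj (partial_x h (reflection z))"
    and "\<And>z. z \<in> uhp \<Longrightarrow> partial_y g z = c * cnj (partial_y h (reflection z))"
proof -
  have x: "((\<lambda>t. g (z + of_real t)) has_vector_derivative - c * cnj (partial_x h (reflection z))) (at 0)"
    if z: "z \<in> uhp" for z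
  proof -
    have "(\<lambda>t::real. h (reflection z + of_real t)) differentiable at 0"
      using h z by (simp add: C1_uhp_def)
    \<comment> \<open>The reflection reverses horizontal motion; the base point is written as -0 to
      fit the chain rule with inner map \<open>uminus\<close>.\<close>
    then have "((\<lambda>t. h (reflection z + of_real t)) has_vector_derivative partial_x h (reflection z)) (at (- 0))"
      unfolding minus_zero partial_x_def by (rule vector_derivative_works[THEN iffD1])
    with has_vector_derivative_minus[OF has_vector_derivative_id]
    have "((\<lambda>t. h (reflection z + of_real t)) \<circ> uminus has_vector_derivative
        (- 1) *\<^sub>R partial_x h (reflection z)) (at (0::real))"
      by (rule vector_diff_chain_at)
    then have "((\<lambda>t. c * cnj (h (reflection z - of_real t))) has_vector_derivative
        c * cnj (- partial_x h (reflection z))) (at 0)"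
      by (intro has_vector_derivative_mult_right has_vector_derivative_cnj) (simp add: o_def)
    then have "((\<lambda>t. g (z + of_real t)) has_vector_derivative
        c * cnj (- partial_x h (reflection z))) (at 0)"
      by (rule has_vector_derivative_transform_within_open[where S = UNIV])
         (use z in \<open>auto simp: g uhp_def reflection_def\<close>)
    then show ?thesis by simp
  qed
  have y: "((\<lambda>t. g (z + \<i> * of_real t)) has_vector_derivative c * cnj (partial_y h (reflection z))) (at 0)"
    if z: "z \<in> uhp" for z
  proof -
    have "(\<lambda>t::real. h (reflection z + \<i> * of_real t)) differentiable at 0"
      using h z by (simp add: C1_uhp_def)
    then have "((\<lambda>t. h (reflection z + \<i> * of_real t)) has_vector_derivative partial_y h (reflection z)) (at 0)"
      unfolding partial_y_def by (rule vector_derivative_works[THEN iffD1])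
    then have "((\<lambda>t. c * cnj (h (reflection z + \<i> * of_real t))) has_vector_derivative
        c * cnj (partial_y h (reflection z))) (at 0)"
      by (intro has_vector_derivative_mult_right has_vector_derivative_cnj)
    then show ?thesis
      \<comment> \<open>These are the parameters for which the vertical line through z stays in
        \<open>uhp\<close>.\<close>
      by (rule has_vector_derivative_transform_within_open[where S = "{- Im z<..}"])
         (use z in \<open>auto simp: g uhp_def reflection_def\<close>)
  qed
  show px: "partial_x g z = - c * cnj (partial_x h (reflection z))" if "z \<in> uhp" for z
    unfolding partial_x_def[of g] by (rule vector_derivative_at[OF x[OF that]])
  show py: "partial_y g z = c * cnj (partial_y h (reflection z))" if "z \<in> uhp" for z
    unfolding partial_y_def[of g] by (rule vector_derivative_at[OF y[OF that]])
  have cont: "continuous_on uhp (\<lambda>z. k (reflection z))" if "continuous_on uhp k" for k :: "complex \<Rightarrow> complex"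
    by (rule continuous_on_compose2[OF that continuous_on_reflection]) auto
  have "continuous_on uhp (partial_x g)"
    by (subst continuous_on_cong[OF refl px], assumption)
       (use h in \<open>auto simp: C1_uhp_def intro!: continuous_intros cont\<close>)
  moreover have "continuous_on uhp (partial_y g)"
    by (subst continuous_on_cong[OF refl py], assumption)
       (use h in \<open>auto simp: C1_uhp_def intro!: continuous_intros cont\<close>)
  ultimately show "C1_uhp g"
    using differentiableI_vector[OF x] differentiableI_vector[OF y] by (auto simp: C1_uhp_def)
qed

text \<open>The Laplacian commutes with the reflection, while complex conjugation replaces \<mu> by
  its conjugate, whence \<mu> real. The condition on \<open>\<psi>'\<close> covers every
  \<open>\<gamma>'\<close> acting as T\<gamma>T.\<close>

lemma eigenspace_reflection:
  assumes "\<Gamma> \<subseteq> carrier PSL2R" "reflection_invariant \<Gamma>" "\<mu> \<in> \<real>"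
    and h: "h \<in> eigenspace \<Gamma> \<psi> \<mu>"
    and \<psi>: "\<And>\<gamma> \<gamma>'. \<gamma> \<in> \<Gamma> \<Longrightarrow> \<gamma>' \<in> \<Gamma> \<Longrightarrow>
              (\<And>z. z \<in> uhp \<Longrightarrow> reflection (act \<gamma> z) = act \<gamma>' (reflection z)) \<Longrightarrow> \<psi>' \<gamma> = cnj (\<psi> \<gamma>')"
  shows "(\<lambda>z. cnj (h (reflection z))) \<in> eigenspace \<Gamma> \<psi>' \<mu>"
proof -
  let ?g = "\<lambda>z. cnj (h (reflection z))"
  have C2: "C1_uhp h" "C1_uhp (partial_x h)" "C1_uhp (partial_y h)"
    using h by (auto simp: eigenspace_def C2_uhp_def)
  note g = C1_uhp_reflection[OF C2(1), of ?g 1, simplified]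
  note gx = C1_uhp_reflection[OF C2(2), of "partial_x ?g" "- 1", simplified g(2), simplified]
  note gy = C1_uhp_reflection[OF C2(3), of "partial_y ?g" 1, simplified g(3), simplified]
  have "C2_uhp ?g"
    using g(1) gx(1) gy(1) by (simp add: C2_uhp_def)
  moreover have "?g (act \<gamma> z) = \<psi>' \<gamma> * ?g z" if \<gamma>: "\<gamma> \<in> \<Gamma>" and z: "z \<in> uhp" for \<gamma> z
  proof -
    obtain \<gamma>' where \<gamma>': "\<gamma>' \<in> \<Gamma>" "\<And>z. z \<in> uhp \<Longrightarrow> reflection (act \<gamma> z) = act \<gamma>' (reflection z)"
      using reflection_conjugate[OF assms(2) \<gamma>] by blast
    then show ?thesis
      using h z \<psi>[OF \<gamma> \<gamma>'] by (simp add: eigenspace_def)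
  qed
  moreover have "- hyperbolic_laplacian ?g z = \<mu> * ?g z" if z: "z \<in> uhp" for z
  proof -
    \<comment> \<open>The two sign changes in the x direction cancel.\<close>
    have "- hyperbolic_laplacian ?g z = cnj (- hyperbolic_laplacian h (reflection z))"
      using gx(2)[OF z] gy(3)[OF z] by (simp add: hyperbolic_laplacian_def reflection_def)
    also have "\<dots> = cnj (\<mu> * h (reflection z))"
      using h z by (simp add: eigenspace_def)
    also have "\<dots> = \<mu> * ?g z"
      using \<open>\<mu> \<in> \<real>\<close> by (simp add: Reals_cnj_iff)
    finally show ?thesis .
  qed
  ultimately show ?thesis
    using h square_integrable_mod_reflection[OF assms(1,2)] by (auto simp: eigenspace_def)
qed

section \<open>Periods of the cusp form and the characters\<close>

text \<open>Conjugating exp(2 pi i n z) amounts to replacing z by -cnj z, and real coefficients are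
  unaffected.\<close>

lemma cusp_form_reflection:
  assumes "has_fourier_coefficients f a" "\<forall>n. a n \<in> \<real>" "z \<in> uhp"
  shows "f (reflection z) = cnj (f z)"
proof -
  have "(\<lambda>n. cnj (a n * exp (2 * of_real pi * \<i> * of_nat n * z))) sums cnj (f z)"
    using assms by (subst sums_cnj) (auto simp: has_fourier_coefficients_def)
  also have "(\<lambda>n. cnj (a n * exp (2 * of_real pi * \<i> * of_nat n * z)))
      = (\<lambda>n. a n * exp (2 * of_real pi * \<i> * of_nat n * reflection z))"
    using assms(2) by (simp add: exp_cnj Reals_cnj_iff reflection_def)
  finally show ?thesis
    using assms by (auto simp: has_fourier_coefficients_def intro: sums_unique2)
qed

text \<open>Phrased with increments for comparing a primitive of the cusp form with its translates
  by the group and its reflected conjugate.\<close>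

lemma constant_difference_uhp:
  assumes "\<And>z. z \<in> uhp \<Longrightarrow> (g has_field_derivative f z) (at z)"
    and "\<And>z. z \<in> uhp \<Longrightarrow> (k has_field_derivative f z) (at z)"
    and "z \<in> uhp" "w \<in> uhp"
  shows "g z - g w = k z - k w"
proof -
  have "((\<lambda>z. g z - k z) has_field_derivative 0) (at z within uhp)" if "z \<in> uhp" for z
    using DERIV_diff[OF assms(1,2), OF that that] by (simp add: has_field_derivative_at_within)
  then obtain c where "\<And>z. z \<in> uhp \<Longrightarrow> g z - k z = c"
    using has_field_derivative_zero_constant[OF convex_uhp, of "\<lambda>z. g z - k z"] by blast
  then have "g z - k z = g w - k w" using assms by simp
  then show ?thesis by (simp add: algebra_simps)
qed

text \<open>The reflection pulls f dz back to minus its conjugate. Thus passing from \<gamma> to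
  T\<gamma>T negates the real part of the period and keeps the imaginary part.\<close>

lemma period_reflection:
  assumes f: "f \<in> cusp_forms2 \<Gamma>" and refl: "\<And>z. z \<in> uhp \<Longrightarrow> f (reflection z) = cnj (f z)"
    and \<Gamma>: "\<Gamma> \<subseteq> carrier PSL2R" and "\<gamma> \<in> \<Gamma>" "\<gamma>' \<in> \<Gamma>"
    and conj: "\<And>z. z \<in> uhp \<Longrightarrow> reflection (act \<gamma> z) = act \<gamma>' (reflection z)"
    and z0: "z0 \<in> uhp"
  shows "contour_integral (linepath z0 (act \<gamma>' z0)) f = - cnj (contour_integral (linepath z0 (act \<gamma> z0)) f)"
proof -
  have "f holomorphic_on uhp" using f by (simp add: cusp_forms2_def)
  then obtain F where "\<And>z. z \<in> uhp \<Longrightarrow> (F has_field_derivative f z) (at z within uhp)"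
    using holomorphic_convex_primitive'[OF convex_uhp open_uhp] by blast
  then have F: "(F has_field_derivative f z) (at z)" if "z \<in> uhp" for z
    using that open_uhp by (metis at_within_open)
  have period: "contour_integral (linepath z w) f = F w - F z" if "z \<in> uhp" "w \<in> uhp" for z w
  proof -
    have "path_image (linepath z w) \<subseteq> uhp"
      using that convex_uhp by (simp add: closed_segment_subset)
    then have "(f has_contour_integral (F (pathfinish (linepath z w)) - F (pathstart (linepath z w)))) (linepath z w)"
      using F by (intro contour_integral_primitive[where S = uhp]) (auto intro: has_field_derivative_at_within)
    then show ?thesis by (simp add: contour_integral_unique)
  qed
  \<comment> \<open>Since f dz is invariant, composing \<open>F\<close> with a group element gives
    another primitive of f; so the period does not depend on the base point.\<close>
  have inv: "F (act \<delta> z) - F (act \<delta> w) = F z - F w" if \<delta>: "\<delta> \<in> \<Gamma>" and "z \<in> uhp" "w \<in> uhp" for \<delta> z w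
  proof (rule constant_difference_uhp[OF _ F \<open>z \<in> uhp\<close> \<open>w \<in> uhp\<close>])
    fix u assume u: "u \<in> uhp"
    have \<delta>': "\<delta> \<in> carrier PSL2R" using \<delta> \<Gamma> by blast
    let ?j = "of_real (rep \<delta> $ 2 $ 1) * u + of_real (rep \<delta> $ 2 $ 2)"
    have "f (act \<delta> u) * (1 / ?j\<^sup>2) = f u"
      using f \<delta> u act_denominator_nonzero[OF \<delta>' u] by (simp add: cusp_forms2_def)
    then show "((\<lambda>u. F (act \<delta> u)) has_field_derivative f u) (at u)"
      using DERIV_chain2[OF F[OF act_uhp[OF \<delta>' u]] DERIV_act[OF \<delta>' u]] by simp
  qed
  have F_refl: "(- cnj (F (reflection z))) - (- cnj (F (reflection w))) = F z - F w"
    if "z \<in> uhp" "w \<in> uhp" for z w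
  proof (rule constant_difference_uhp[OF _ F \<open>z \<in> uhp\<close> \<open>w \<in> uhp\<close>])
    fix u assume u: "u \<in> uhp"
    have "((\<lambda>v. F (- v)) has_field_derivative f (- cnj u) * (- 1)) (at (cnj u))"
      using F[of "reflection u"] u unfolding reflection_in_uhp_iff
      by (intro DERIV_chain2[where g = uminus and f = F]) (auto intro!: derivative_eq_intros simp: reflection_def)
    then have "(cnj \<circ> (\<lambda>v. F (- v)) \<circ> cnj has_field_derivative cnj (f (- cnj u) * (- 1))) (at u)"
      by (rule has_field_derivative_cnj_cnj)
    then have "((\<lambda>u. - cnj (F (reflection u))) has_field_derivative - cnj (f (- cnj u) * (- 1))) (at u)"
      by (intro DERIV_minus) (simp add: o_def reflection_def)
    then show "((\<lambda>u. - cnj (F (reflection u))) has_field_derivative f u) (at u)"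
      using refl[OF u] by (simp add: reflection_def)
  qed
  have \<gamma>z0: "act \<gamma> z0 \<in> uhp" "act \<gamma>' z0 \<in> uhp" using \<Gamma> assms(4,5) z0 act_uhp by blast+
  have "contour_integral (linepath z0 (act \<gamma>' z0)) f = F (act \<gamma>' z0) - F z0"
    by (rule period) fact+
  \<comment> \<open>The base point moves to \<open>reflection z0\<close>, where \<open>conj\<close>
    applies.\<close>
  also have "\<dots> = F (act \<gamma>' (reflection z0)) - F (reflection z0)"
    using inv[OF \<open>\<gamma>' \<in> \<Gamma>\<close>, of z0 "reflection z0"] z0 by (simp add: algebra_simps)
  also have "\<dots> = F (reflection (act \<gamma> z0)) - F (reflection z0)"
    using conj[OF z0] by simp
  also have "\<dots> = - cnj (- cnj (F (reflection (act \<gamma> z0))) - (- cnj (F (reflection z0))))"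
    by simp
  also have "\<dots> = - cnj (F (act \<gamma> z0) - F z0)"
    using F_refl[OF \<gamma>z0(1) z0] by simp
  also have "\<dots> = - cnj (contour_integral (linepath z0 (act \<gamma> z0)) f)"
    using period[OF z0 \<gamma>z0(1)] by simp
  finally show ?thesis .
qed

text \<open>The reflection negates the first period and \<open>cnj\<close> negates the whole
  exponent; in total only the second parameter changes sign.\<close>

lemma character_reflection:
  assumes "f \<in> cusp_forms2 \<Gamma>" and "\<And>z. z \<in> uhp \<Longrightarrow> f (reflection z) = cnj (f z)"
    and "\<Gamma> \<subseteq> carrier PSL2R" and "\<gamma> \<in> \<Gamma>" "\<gamma>' \<in> \<Gamma>"
    and "\<And>z. z \<in> uhp \<Longrightarrow> reflection (act \<gamma> z) = act \<gamma>' (reflection z)"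
    and "z0 \<in> uhp"
  shows "character f z0 (x, - y) \<gamma> = cnj (character f z0 (x, y) \<gamma>')"
  using period_reflection[OF assms]
  by (simp add: character_def alpha1_integral_def alpha2_integral_def exp_cnj algebra_simps)

text \<open>The involution \<open>R\<close> exchanges the two eigenspaces and fixes 0. Triviality is
  the property that \<open>singular_point\<close> tests on the critical line.\<close>

lemma eigenspace_character_trivial_iff:
  assumes "f \<in> cusp_forms2 \<Gamma>" and "\<And>z. z \<in> uhp \<Longrightarrow> f (reflection z) = cnj (f z)"
    and \<Gamma>: "\<Gamma> \<subseteq> carrier PSL2R" "reflection_invariant \<Gamma>" and "z0 \<in> uhp" and \<mu>: "\<mu> \<in> \<real>"
  shows "eigenspace \<Gamma> (\<lambda>\<gamma>. cnj (character f z0 (x, - y) \<gamma>)) \<mu> = {\<lambda>_. 0} \<longleftrightarrow>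
         eigenspace \<Gamma> (\<lambda>\<gamma>. cnj (character f z0 (x, y) \<gamma>)) \<mu> = {\<lambda>_. 0}"
proof -
  let ?E = "\<lambda>y. eigenspace \<Gamma> (\<lambda>\<gamma>. cnj (character f z0 (x, y) \<gamma>)) \<mu>"
  define R where "R = (\<lambda>(h :: complex \<Rightarrow> complex) z. cnj (h (reflection z)))"
  have R_in: "R h \<in> ?E (- y)" if "h \<in> ?E y" for h y
    unfolding R_def
    by (rule eigenspace_reflection[OF \<Gamma> \<mu> that]) (simp add: character_reflection[OF assms(1-3) _ _ _ assms(5)])
  have R_R: "R (R h) = h" for h by (simp add: R_def)
  have R_0: "R (\<lambda>_. 0) = (\<lambda>_. 0)" by (simp add: R_def)
  have "?E y = {\<lambda>_. 0}" if "?E (- y) = {\<lambda>_. 0}" for y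
  proof
    show "?E y \<subseteq> {\<lambda>_. 0}"
    proof
      fix h assume "h \<in> ?E y"
      from R_in[OF this] have "R h = (\<lambda>_. 0)" using that by simp
      then have "R (R h) = (\<lambda>_. 0)" using R_0 by simp
      then show "h \<in> {\<lambda>_. 0}" using R_R by simp
    qed
    \<comment> \<open>Membership of 0 in \<open>?E y\<close> is obtained by reflecting the 0 of
      \<open>?E (- y)\<close>.\<close>
    have "R (\<lambda>_. 0) \<in> ?E (- (- y))"
      by (rule R_in) (simp only: that singletonI)
    then show "{\<lambda>_. 0} \<subseteq> ?E y" by (simp add: R_0)
  qed
  from this[of y] this[of "- y"] show ?thesis unfolding minus_minus by blast
qed

section \<open>From the embedded eigenvalue to a resonance\<close>

theorem theorem5p11:
  fixes \<Gamma> :: "(real^2^2) set set"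
    and f :: "complex \<Rightarrow> complex" and a :: "nat \<Rightarrow> complex" and z0 :: complex
    and E :: "real \<times> real \<Rightarrow> complex \<Rightarrow> complex \<Rightarrow> complex"
    and \<phi> :: "real \<times> real \<Rightarrow> complex \<Rightarrow> complex"
    and r :: real and s\<^sub>j :: complex and S :: "real \<times> real \<Rightarrow> complex" and l :: nat
  assumes "discrete_subgroup \<Gamma>" and "cofinite_area \<Gamma>"
    and "one_cusp_at_infinity \<Gamma>"
    and "stabilizer_infinity \<Gamma> = generate PSL2R {unit_translation}"
    and "has_genus \<Gamma> 1"
    and "reflection_invariant \<Gamma>"
    and "f \<in> cusp_forms2 \<Gamma>"
    and "has_fourier_coefficients f a"
    and "\<forall>n. a n \<in> \<real>"
    and "\<exists>n. a n = 1 \<and> (\<forall>m<n. a m = 0)"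
    and "z0 \<in> uhp"
    and "\<And>\<epsilon>. eisenstein_continuation \<Gamma> (character f z0 \<epsilon>) (E \<epsilon>) (\<phi> \<epsilon>)"
    and "s\<^sub>j = Complex (1/2) r" and "r \<noteq> 0"
    and "simple_embedded_eigenvalue \<Gamma> s\<^sub>j"
    and "\<exists>u\<in>eigenspace \<Gamma> (\<lambda>_. 1) (s\<^sub>j * (1 - s\<^sub>j)).
           u \<noteq> (\<lambda>_. 0) \<and> (\<forall>z\<in>uhp. u (reflection z) = u z)"
    and "singular_point_branch \<Gamma> (character f z0) \<phi> s\<^sub>j S"
    and "(deriv ^^ 2) (\<lambda>\<epsilon>\<^sub>2. Re (S (0, \<epsilon>\<^sub>2))) 0 \<noteq> 0"
    and "l \<ge> 1" and "(deriv ^^ l) (\<lambda>\<epsilon>\<^sub>1. Re (S (\<epsilon>\<^sub>1, 0))) 0 \<noteq> 0"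
  shows "\<forall>\<^sub>F \<epsilon> in at (0, 0). Re (S \<epsilon>) < 1/2 \<and> resonance (\<phi> \<epsilon>) (S \<epsilon>)"
proof -
  have \<Gamma>: "\<Gamma> \<subseteq> carrier PSL2R"
    using assms(1) by (simp add: discrete_subgroup_def subgroup.subset)
  have refl: "f (reflection z) = cnj (f z)" if "z \<in> uhp" for z
    using cusp_form_reflection[OF assms(8,9) that] .
  obtain r' U where U: "open U" "(0, 0) \<in> U"
    and S: "\<And>\<epsilon>. \<epsilon> \<in> U \<Longrightarrow> {s \<in> ball s\<^sub>j r'. singular_point \<Gamma> (character f z0 \<epsilon>) (\<phi> \<epsilon>) s} = {S \<epsilon>}"
    and an: "\<And>\<epsilon>. \<epsilon> \<in> U \<Longrightarrow> real_analytic_at S \<epsilon>"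
    and S0: "S (0, 0) = s\<^sub>j"
    using assms(17) by (auto simp: singular_point_branch_def)
  have S_sing: "S \<epsilon> \<in> ball s\<^sub>j r'" "singular_point \<Gamma> (character f z0 \<epsilon>) (\<phi> \<epsilon>) (S \<epsilon>)" if "\<epsilon> \<in> U" for \<epsilon>
    using S[OF that] by blast+
  \<comment> \<open>Off the critical line a singular point is a resonance by definition, so only the
    strict inequality for the real part remains to be shown.\<close>
  have dichotomy: "Re (S \<epsilon>) = 1/2 \<or> Re (S \<epsilon>) < 1/2 \<and> resonance (\<phi> \<epsilon>) (S \<epsilon>)" if "\<epsilon> \<in> U" for \<epsilon>
    using S_sing(2)[OF that] by (auto simp: singular_point_def resonance_def)
  have sym: "Re (S (x, - y)) = 1/2"
    if xy: "(x, y) \<in> U" "(x, - y) \<in> U" and half: "Re (S (x, y)) = 1/2" for x y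
  proof -
    let ?s = "S (x, y)"
    \<comment> \<open>On the critical line the eigenvalue is real, so \<open>?s\<close> is also
      singular at (x, -y). It lies in the common ball, where the singular point is unique.\<close>
    have "?s * (1 - ?s) \<in> \<real>"
      using half by (simp add: complex_is_Real_iff)
    then have "singular_point \<Gamma> (character f z0 (x, - y)) (\<phi> (x, - y)) ?s"
      using S_sing(2)[OF xy(1)] half eigenspace_character_trivial_iff[OF assms(7) refl \<Gamma> assms(6,11)]
      by (simp add: singular_point_def resonance_def)
    then have "?s = S (x, - y)"
      using S[OF xy(2)] S_sing(1)[OF xy(1)] by blast
    then show ?thesis using half by simp
  qed
  obtain \<rho> c where "0 < \<rho>" and c: "\<And>x y. \<bar>x\<bar> < \<rho> \<Longrightarrow> \<bar>y\<bar> < \<rho> \<Longrightarrow>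
      ((\<lambda>(m, n). c (m, n) * of_real x ^ m * of_real y ^ n) has_sum S (x, y)) UNIV"
    using an[OF U(2)] by (force simp: real_analytic_at_def)
  have Re_c: "((\<lambda>(m, n). Re (c (m, n)) * x ^ m * y ^ n) has_sum Re (S (x, y))) UNIV"
    if "\<bar>x\<bar> < \<rho>" "\<bar>y\<bar> < \<rho>" for x y
    using has_sum_Re[OF c[OF that]] by (simp add: case_prod_unfold flip: of_real_power)
  have near: "\<forall>\<^sub>F \<epsilon> in nhds (0, 0). \<epsilon> \<in> U"
    using U by (rule eventually_nhds_in_open)
  \<comment> \<open>\<open>U\<close> may fail to be symmetric in the second parameter, so mirror
    points are shown to lie in it eventually.\<close>
  have "((\<lambda>p. (fst p, - snd p)) \<longlongrightarrow> (0, 0)) (nhds (0::real, 0::real))"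
    by (auto intro!: tendsto_eq_intros filterlim_ident)
  from eventually_compose_filterlim[OF near this]
  have near': "\<forall>\<^sub>F p in nhds (0, 0). (fst p, - snd p) \<in> U" .
  have S00: "Re (S (0, 0)) = 1/2" using S0 assms(13) by simp
  have "\<forall>\<^sub>F \<epsilon> in at (0, 0). Re (S \<epsilon>) < Re (S (0, 0))"
  proof (rule double_power_series_eventually_less[OF \<open>0 < \<rho>\<close> Re_c, where l = l])
    show "\<forall>\<^sub>F p in nhds (0, 0). Re (S p) \<le> Re (S (0, 0))"
      using near by eventually_elim (use dichotomy S00 in force)
    show "\<forall>\<^sub>F (x, y) in nhds (0, 0). Re (S (x, y)) = Re (S (0, 0)) \<longrightarrow> Re (S (x, - y)) = Re (S (0, 0))"
      unfolding S00 using near near' by eventually_elim (use sym in auto)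
  qed (use assms(18-20) in auto)
  moreover have "\<forall>\<^sub>F \<epsilon> in at (0, 0). \<epsilon> \<in> U"
    using near by (simp add: eventually_nhds_conv_at)
  ultimately show ?thesis
    by eventually_elim (use dichotomy S00 in force)
qed

end
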